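(* Let $G$ be a finite group and let $(\mu_1,V_1),\dots,(\mu_r,V_r)$ be the full list of pairwise non-isomorphic irreducible representations of $G$ (over the field $\mathbb{R}$ or $\mathbb{C}$ under consideration). Let $V$ and $W$ be finite-dimensional (real or complex) representations of $G$, decomposed as $$V=\bigoplus_{i\in I}V_i^{\oplus m_i},\qquad W=\bigoplus_{j\in J}V_j^{\oplus n_j},$$ where $I,J\subseteq\{1,\dots,r\}$ and $m_i,n_j$ are positive integers. Then these decompositions induce (componentwise) the following decompositions of the function spaces: $$\mathcal{F}_V=\bigoplus_{i\in I}\mathcal{F}_{V_i}^{\oplus m_i},\qquad \mathcal{F}_W=\bigoplus_{j\in J}\mathcal{F}_{V_j}^{\oplus n_j}.$$
   Context: For a vector space $U$, $\mathcal{F}_U:=\{f:G\to U\}$ denotes the vector space of all functions from $G$ to $U$, with pointwise addition and scalar multiplication. The decompositions of $\mathcal{F}_V$ and $\mathcal{F}_W$ are decompositions of vector spaces; "induced componentwise" means that $f\in\mathcal{F}_V$ corresponds to the tuple $(f_{ik})_{i\in I,\,1\le k\le m_i}$, where $f_{ik}(g)\in V_i$ is the component of $f(g)$ in the $k$-th copy of $V_i$ in $V$, and similarly for $W$. Decompositions of $V$ and $W$ as stated exist by Maschke's theorem. *)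

theory Defs
  imports "Jordan_Normal_Form.VS_Connect" "HOL-Algebra.Group_Action"
begin

text \<open>
  Vector spaces are carrier-based, so that spaces of different dimensions can form one family.
  \<open>K\<close> is meant to be \<open>class_ring :: 'k ring\<close> for a type \<open>'k :: real_normed_field\<close>, that is (up to
  isomorphism, by Gelfand--Mazur) \<open>\<real>\<close> or \<open>\<complex>\<close>.

  Via \<^const>\<open>BijGroup\<close>, \<^const>\<open>group_action\<close> requires each operator \<open>\<mu> g\<close> to be
  \<^const>\<open>undefined\<close> outside \<open>carrier V\<close>; this only fixes a normal form of the operators.
\<close>
definition group_rep ::
  "('k, 'x) ring_scheme \<Rightarrow> ('g, 'y) monoid_scheme \<Rightarrow> ('g \<Rightarrow> 'v \<Rightarrow> 'v) \<Rightarrow> ('k, 'v) module \<Rightarrow> bool" where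
  "group_rep K G \<mu> V \<longleftrightarrow>
     vectorspace K V \<and> group_action G (carrier V) \<mu> \<and>
     (\<forall>g\<in>carrier G. linear_map K V V (\<mu> g))"

definition irreducible_rep ::
  "('k, 'x) ring_scheme \<Rightarrow> ('g, 'y) monoid_scheme \<Rightarrow> ('g \<Rightarrow> 'v \<Rightarrow> 'v) \<Rightarrow> ('k, 'v) module \<Rightarrow> bool" where
  "irreducible_rep K G \<mu> V \<longleftrightarrow>
     group_rep K G \<mu> V \<and> carrier V \<noteq> {\<zero>\<^bsub>V\<^esub>} \<and>
     (\<forall>U. subspace K U V \<and> (\<forall>g\<in>carrier G. \<mu> g ` U \<subseteq> U) \<longrightarrow> U = {\<zero>\<^bsub>V\<^esub>} \<or> U = carrier V)"

definition linear_iso ::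
  "('k, 'x) ring_scheme \<Rightarrow> ('k, 'v) module \<Rightarrow> ('k, 'w) module \<Rightarrow> ('v \<Rightarrow> 'w) \<Rightarrow> bool" where
  "linear_iso K V W T \<longleftrightarrow> linear_map K V W T \<and> bij_betw T (carrier V) (carrier W)"

definition rep_iso ::
  "('k, 'x) ring_scheme \<Rightarrow> ('g, 'y) monoid_scheme \<Rightarrow> ('g \<Rightarrow> 'v \<Rightarrow> 'v) \<Rightarrow> ('k, 'v) module \<Rightarrow>
   ('g \<Rightarrow> 'w \<Rightarrow> 'w) \<Rightarrow> ('k, 'w) module \<Rightarrow> ('v \<Rightarrow> 'w) \<Rightarrow> bool" where
  "rep_iso K G \<mu> V \<nu> W T \<longleftrightarrow>
     linear_iso K V W T \<and> (\<forall>g\<in>carrier G. \<forall>v\<in>carrier V. T (\<mu> g v) = \<nu> g (T v))"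

definition isomorphic_reps ::
  "('k, 'x) ring_scheme \<Rightarrow> ('g, 'y) monoid_scheme \<Rightarrow> ('g \<Rightarrow> 'v \<Rightarrow> 'v) \<Rightarrow> ('k, 'v) module \<Rightarrow>
   ('g \<Rightarrow> 'w \<Rightarrow> 'w) \<Rightarrow> ('k, 'w) module \<Rightarrow> bool" where
  "isomorphic_reps K G \<mu> V \<nu> W \<longleftrightarrow> (\<exists>T. rep_iso K G \<mu> V \<nu> W T)"

text \<open>
  The list \<open>(\<mu> 1, Vs 1), \<dots>, (\<mu> r, Vs r)\<close> represents each isomorphism class of irreducible
  representations exactly once. Types cannot be quantified inside a formula, so completeness is
  tested on representations whose carrier lies in \<open>nat \<Rightarrow> 'k\<close>. For a finite group this loses
  nothing: an irreducible representation is then finite-dimensional, and every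
  finite-dimensional space over \<open>K\<close> has an isomorphic copy with carrier in that type.
\<close>
definition full_irrep_list ::
  "('k, 'x) ring_scheme \<Rightarrow> ('g, 'y) monoid_scheme \<Rightarrow> nat \<Rightarrow>
   (nat \<Rightarrow> 'g \<Rightarrow> 'u \<Rightarrow> 'u) \<Rightarrow> (nat \<Rightarrow> ('k, 'u) module) \<Rightarrow> bool" where
  "full_irrep_list K G r \<mu> Vs \<longleftrightarrow>
     (\<forall>i\<in>{1..r}. irreducible_rep K G (\<mu> i) (Vs i)) \<and>
     (\<forall>i\<in>{1..r}. \<forall>j\<in>{1..r}. i \<noteq> j \<longrightarrow> \<not> isomorphic_reps K G (\<mu> i) (Vs i) (\<mu> j) (Vs j)) \<and>
     (\<forall>\<nu> (U :: ('k, nat \<Rightarrow> 'k) module). irreducible_rep K G \<nu> U \<longrightarrow>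
        (\<exists>i\<in>{1..r}. isomorphic_reps K G \<nu> U (\<mu> i) (Vs i)))"

text \<open>
  External direct sum of a family of vector spaces over a finite index set \<open>A\<close>, where it is the
  full product. As for every vector space modelled by the record \<^typ>\<open>('k, 'v) module\<close>, the
  ring fields \<^const>\<open>mult\<close> and \<^const>\<open>one\<close> carry no meaning.
\<close>
definition ext_sum :: "'a set \<Rightarrow> ('a \<Rightarrow> ('k, 'v) module) \<Rightarrow> ('k, 'a \<Rightarrow> 'v) module" where
  "ext_sum A M =
     \<lparr>carrier = (\<Pi>\<^sub>E a\<in>A. carrier (M a)),
      mult = undefined,
      one = undefined,
      zero = (\<lambda>a\<in>A. \<zero>\<^bsub>M a\<^esub>),
      add = (\<lambda>x y. \<lambda>a\<in>A. x a \<oplus>\<^bsub>M a\<^esub> y a),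
      smult = (\<lambda>c x. \<lambda>a\<in>A. c \<odot>\<^bsub>M a\<^esub> x a)\<rparr>"

definition ext_sum_rep ::
  "'a set \<Rightarrow> ('a \<Rightarrow> 'g \<Rightarrow> 'v \<Rightarrow> 'v) \<Rightarrow> ('a \<Rightarrow> ('k, 'v) module) \<Rightarrow>
   'g \<Rightarrow> ('a \<Rightarrow> 'v) \<Rightarrow> ('a \<Rightarrow> 'v)" where
  "ext_sum_rep A \<mu> M g = (\<lambda>x\<in>carrier (ext_sum A M). \<lambda>a\<in>A. \<mu> a g (x a))"

text \<open>
  Index set of the direct sum over \<open>i \<in> I\<close> of \<open>m i\<close> copies of \<open>X i\<close>; the pair \<open>(i, k)\<close>
  stands for the \<open>k\<close>-th copy of \<open>X i\<close>.
\<close>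
definition copies :: "nat set \<Rightarrow> (nat \<Rightarrow> nat) \<Rightarrow> (nat \<times> nat) set" where
  "copies I m = (SIGMA i:I. {1..m i})"

abbreviation mult_sum ::
  "nat set \<Rightarrow> (nat \<Rightarrow> nat) \<Rightarrow> (nat \<Rightarrow> ('k, 'v) module) \<Rightarrow> ('k, nat \<times> nat \<Rightarrow> 'v) module" where
  "mult_sum I m Xs \<equiv> ext_sum (copies I m) (\<lambda>(i, k). Xs i)"

abbreviation mult_sum_rep ::
  "nat set \<Rightarrow> (nat \<Rightarrow> nat) \<Rightarrow> (nat \<Rightarrow> 'g \<Rightarrow> 'v \<Rightarrow> 'v) \<Rightarrow> (nat \<Rightarrow> ('k, 'v) module) \<Rightarrow>
   'g \<Rightarrow> (nat \<times> nat \<Rightarrow> 'v) \<Rightarrow> (nat \<times> nat \<Rightarrow> 'v)" where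
  "mult_sum_rep I m \<mu> Xs \<equiv> ext_sum_rep (copies I m) (\<lambda>(i, k). \<mu> i) (\<lambda>(i, k). Xs i)"

text \<open>
  The space \<open>\<F>\<^sub>U\<close> of all functions from \<open>G\<close> to \<open>U\<close>; a function on \<open>carrier G\<close> is represented
  by its extension that is \<^const>\<open>undefined\<close> elsewhere.
\<close>
definition fun_space ::
  "('g, 'y) monoid_scheme \<Rightarrow> ('k, 'u) module \<Rightarrow> ('k, 'g \<Rightarrow> 'u) module" where
  "fun_space G U =
     \<lparr>carrier = carrier G \<rightarrow>\<^sub>E carrier U,
      mult = undefined,
      one = undefined,
      zero = (\<lambda>g\<in>carrier G. \<zero>\<^bsub>U\<^esub>),
      add = (\<lambda>f h. \<lambda>g\<in>carrier G. f g \<oplus>\<^bsub>U\<^esub> h g),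
      smult = (\<lambda>c f. \<lambda>g\<in>carrier G. c \<odot>\<^bsub>U\<^esub> f g)\<rparr>"

text \<open>
  For an identification \<open>\<phi>\<close> of \<open>V\<close> with a direct sum over \<open>A\<close>, the function \<open>f\<close> from \<open>G\<close> to \<open>V\<close>
  is sent to the tuple \<open>(f\<^sub>a)\<^bsub>a\<in>A\<^esub>\<close> where \<open>f\<^sub>a(g)\<close> is the \<open>a\<close>-component of \<open>f(g)\<close>.
\<close>
definition fun_components ::
  "('g, 'y) monoid_scheme \<Rightarrow> 'a set \<Rightarrow> ('v \<Rightarrow> 'a \<Rightarrow> 'u) \<Rightarrow> ('g \<Rightarrow> 'v) \<Rightarrow> 'a \<Rightarrow> 'g \<Rightarrow> 'u" where
  "fun_components G A \<phi> f = (\<lambda>a\<in>A. \<lambda>g\<in>carrier G. \<phi> (f g) a)"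

end

theory Submission
  imports Defs
begin

text \<open>A function into a product is the same thing as a tuple of functions: exchanging the
  arguments \<open>g\<close> and \<open>a\<close> identifies the functions from \<open>G\<close> to
  the product of the \<open>M a\<close> with the product of the function spaces of the
  \<open>M a\<close>. All operations are pointwise on both sides, so this exchange is linear.
  Composing with a linear isomorphism \<phi> from \<open>V\<close> to the product first keeps it
  linear and bijective. This is \<open>linear_iso_fun_components\<close>, for an arbitrary index set
  \<open>A\<close>; the theorem is the instance \<open>A = copies I m\<close>, and likewise
  \<open>copies J n\<close>, applied to the linear isomorphisms contained in the given equivalences
  of representations.\<close>

lemma vectorspace_ext_sum:
  fixes K :: "('k, 'x) ring_scheme" and M :: "'a \<Rightarrow> ('k, 'v) module"
  assumes "field K" and M: "\<And>a. a \<in> A \<Longrightarrow> vectorspace K (M a)"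
  shows "vectorspace K (ext_sum A M)"
proof -
  have mod: "module K (M a)" and grp: "abelian_group (M a)" if "a \<in> A" for a
    using M[OF that] by (simp_all add: vectorspace_def Module.module_def)
  have comp: "v a \<in> carrier (M a)" if "v \<in> (\<Pi>\<^sub>E a\<in>A. carrier (M a))" "a \<in> A" for v a
    using that by (rule PiE_mem)
  show ?thesis
  proof (rule vs_criteria)
    show "\<forall>v\<in>carrier (ext_sum A M). \<exists>w\<in>carrier (ext_sum A M).
        v \<oplus>\<^bsub>ext_sum A M\<^esub> w = \<zero>\<^bsub>ext_sum A M\<^esub>"
    proof
      fix v assume v: "v \<in> carrier (ext_sum A M)"
      let ?w = "\<lambda>a\<in>A. \<ominus>\<^bsub>M a\<^esub> v a"
      show "\<exists>w\<in>carrier (ext_sum A M). v \<oplus>\<^bsub>ext_sum A M\<^esub> w = \<zero>\<^bsub>ext_sum A M\<^esub>"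
      proof
        show "?w \<in> carrier (ext_sum A M)"
          using v grp by (auto simp: ext_sum_def intro!: abelian_group.a_inv_closed)
        show "v \<oplus>\<^bsub>ext_sum A M\<^esub> ?w = \<zero>\<^bsub>ext_sum A M\<^esub>"
          using v grp by (auto simp: ext_sum_def abelian_group.r_neg intro!: restrict_ext dest: PiE_mem)
      qed
    qed
  \<comment> \<open>The other axioms hold in each component. \<open>restrict_ext\<close> compares
    two restricted tuples; where one side is a bare vector, as in the unit laws,
    \<open>PiE_ext\<close> uses that the vector is extensional.\<close>
  qed (use \<open>field K\<close> mod grp in \<open>auto simp: ext_sum_def abelian_monoid.zero_closed
         abelian_monoid.a_closed abelian_group.axioms(1) abelian_monoid.a_assoc abelian_monoid.r_zero
         module.smult_one module.smult_assoc1[of K] module.smult_l_distr[of K]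
         module.smult_r_distr[of K] comp
         intro!: restrict_ext abelian_monoid.a_comm module.smult_closed[of K]
           PiE_ext[where k = A and s = "\<lambda>a. carrier (M a)"]\<close>)
qed

text \<open>Functions are tuples indexed by group elements, so one verification of the vector space
  axioms serves both constructions.\<close>

lemma fun_space_eq_ext_sum: "fun_space G U = ext_sum (carrier G) (\<lambda>_. U)"
  by (simp add: fun_space_def ext_sum_def)

lemma vectorspace_fun_space:
  assumes "vectorspace K U"
  shows "vectorspace K (fun_space G U)"
  unfolding fun_space_eq_ext_sum using assms
  by (intro vectorspace_ext_sum vectorspace.axioms(2))

text \<open>Linearity is that of \<phi>, read off at each \<open>g\<close> and each component
  \<open>a\<close>. Bijectivity comes from an explicit inverse.\<close>

lemma linear_iso_fun_components:
  fixes K :: "('k, 'x) ring_scheme" and V :: "('k, 'v) module" and M :: "'a \<Rightarrow> ('k, 'u) module"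
  assumes iso: "linear_iso K V (ext_sum A M) \<phi>"
    and M: "\<And>a. a \<in> A \<Longrightarrow> vectorspace K (M a)"
  shows "linear_iso K (fun_space G V) (ext_sum A (\<lambda>a. fun_space G (M a))) (fun_components G A \<phi>)"
proof -
  let ?F = "fun_space G V" and ?S = "ext_sum A (\<lambda>a. fun_space G (M a))" and ?C = "fun_components G A \<phi>"
  have lin: "linear_map K V (ext_sum A M) \<phi>" and bij: "bij_betw \<phi> (carrier V) (carrier (ext_sum A M))"
    using iso by (simp_all add: linear_iso_def)
  have V: "vectorspace K V" and hom: "\<phi> \<in> LinearCombinations.module_hom K V (ext_sum A M)"
    using lin by (simp_all add: linear_map_def mod_hom_def mod_hom_axioms_def)
  have F: "vectorspace K ?F" and S: "vectorspace K ?S"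
    using V M by (auto intro!: vectorspace_fun_space vectorspace_ext_sum intro: vectorspace.axioms(2))
  have \<phi>_in: "\<phi> v \<in> (\<Pi>\<^sub>E a\<in>A. carrier (M a))" if "v \<in> carrier V" for v
    using bij_betwE[OF bij] that by (simp add: ext_sum_def)
  have \<phi>_add: "\<phi> (v \<oplus>\<^bsub>V\<^esub> w) a = \<phi> v a \<oplus>\<^bsub>M a\<^esub> \<phi> w a"
    if "v \<in> carrier V" "w \<in> carrier V" "a \<in> A" for v w a
    using hom that by (simp add: LinearCombinations.module_hom_def ext_sum_def)
  have \<phi>_smult: "\<phi> (c \<odot>\<^bsub>V\<^esub> v) a = c \<odot>\<^bsub>M a\<^esub> \<phi> v a"
    if "c \<in> carrier K" "v \<in> carrier V" "a \<in> A" for c v a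
    using hom that by (simp add: LinearCombinations.module_hom_def ext_sum_def)
  have C_in: "?C \<in> carrier ?F \<rightarrow> carrier ?S"
    using \<phi>_in by (fastforce simp: fun_components_def fun_space_def ext_sum_def)
  have "?C \<in> LinearCombinations.module_hom K ?F ?S"
    using C_in by (auto simp: LinearCombinations.module_hom_def fun_components_def fun_space_def ext_sum_def
        intro!: restrict_ext \<phi>_add \<phi>_smult)
  then have "linear_map K ?F ?S ?C"
    using F S by (simp add: linear_map_def mod_hom_def mod_hom_axioms_def vectorspace_def)
  moreover have "bij_betw ?C (carrier ?F) (carrier ?S)"
  proof (rule bij_betwI)
    \<comment> \<open>The inverse: at each \<open>g\<close>, gather the values of all components
      into one element of the direct sum and pull it back along \<phi>.\<close>
    define D where "D t = (\<lambda>g\<in>carrier G. inv_into (carrier V) \<phi> (\<lambda>a\<in>A. t a g))"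
      for t :: "'a \<Rightarrow> _ \<Rightarrow> 'u"
    have t_in: "(\<lambda>a\<in>A. t a g) \<in> carrier (ext_sum A M)"
      if "t \<in> carrier ?S" "g \<in> carrier G" for t g
      using that by (fastforce simp: ext_sum_def fun_space_def)
    note inv_in = bij_betwE[OF bij_betw_inv_into[OF bij], rule_format]
    show "?C \<in> carrier ?F \<rightarrow> carrier ?S" by (fact C_in)
    show "D \<in> carrier ?S \<rightarrow> carrier ?F"
      using inv_in t_in by (auto simp: D_def fun_space_def[of G V])
    show "D (?C f) = f" if "f \<in> carrier ?F" for f
    proof
      fix g
      show "D (?C f) g = f g"
      \<comment> \<open>On the group, the components of \<open>f g\<close> reassemble to exactly
        \<open>\<phi> (f g)\<close>, which is extensional on \<open>A\<close>; off it, both sides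
        are \<open>undefined\<close>.\<close>
      proof (cases "g \<in> carrier G")
        case True
        then have f: "f g \<in> carrier V"
          using that by (auto simp: fun_space_def)
        then have "(\<lambda>a\<in>A. ?C f a g) = \<phi> (f g)"
          using True \<phi>_in[OF f] by (auto simp: fun_components_def fun_eq_iff PiE_def extensional_def)
        then show ?thesis
          using True f bij by (simp add: D_def bij_betw_inv_into_left)
      qed (use that in \<open>auto simp: D_def fun_space_def PiE_def extensional_def\<close>)
    qed
    show "?C (D t) = t" if t: "t \<in> carrier ?S" for t
    proof (intro ext)
      fix a g
      have "\<phi> (D t g) = (\<lambda>a\<in>A. t a g)" if "g \<in> carrier G"
        using that t_in[OF t that] bij by (simp add: D_def bij_betw_inv_into_right)
      then show "?C (D t) a g = t a g"
        \<comment> \<open>Indices outside \<open>A\<close> and arguments outside the group are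
          settled by extensionality of \<open>t\<close> and of its components.\<close>
        using t by (auto simp: fun_components_def fun_space_def ext_sum_def PiE_def extensional_def Pi_def)
    qed
  qed
  ultimately show ?thesis by (simp add: linear_iso_def)
qed

lemma linear_iso_fun_components_mult_sum:
  assumes "linear_iso K V (mult_sum I m Xs) \<phi>"
    and "\<And>i. i \<in> I \<Longrightarrow> vectorspace K (Xs i)"
  shows "linear_iso K (fun_space G V) (mult_sum I m (\<lambda>i. fun_space G (Xs i)))
           (fun_components G (copies I m) \<phi>)"
proof -
  \<comment> \<open>The general lemma leaves the case split on the pair inside
    \<open>fun_space\<close>; \<open>mult_sum\<close> has it outside.\<close>
  have eq: "(\<lambda>a. fun_space G (case a of (i, k) \<Rightarrow> Xs i)) = (\<lambda>(i, k). fun_space G (Xs i))"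
    by (simp add: fun_eq_iff)
  moreover have "vectorspace K (case a of (i, k) \<Rightarrow> Xs i)" if "a \<in> copies I m" for a
    using that assms(2) by (auto simp: copies_def)
  ultimately show ?thesis
    using linear_iso_fun_components[OF assms(1), of G] unfolding eq by blast
qed

theorem theorem3p1:
  fixes K :: "'k :: real_normed_field ring"
    and G :: "('g, 'y) monoid_scheme"
    and r :: nat
    and \<mu> :: "nat \<Rightarrow> 'g \<Rightarrow> 'u \<Rightarrow> 'u" and Vs :: "nat \<Rightarrow> ('k, 'u) module"
    and \<rho> :: "'g \<Rightarrow> 'v \<Rightarrow> 'v" and V :: "('k, 'v) module"
    and \<sigma> :: "'g \<Rightarrow> 'w \<Rightarrow> 'w" and W :: "('k, 'w) module"
    and I J :: "nat set" and m n :: "nat \<Rightarrow> nat"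
    and \<phi> :: "'v \<Rightarrow> nat \<times> nat \<Rightarrow> 'u" and \<psi> :: "'w \<Rightarrow> nat \<times> nat \<Rightarrow> 'u"
  assumes "K = class_ring"
    and "group G" and "finite (carrier G)"
    and "full_irrep_list K G r \<mu> Vs"
    and "group_rep K G \<rho> V" and "vectorspace.fin_dim K V"
    and "group_rep K G \<sigma> W" and "vectorspace.fin_dim K W"
    and "I \<subseteq> {1..r}" and "\<And>i. i \<in> I \<Longrightarrow> m i > 0"
    and "J \<subseteq> {1..r}" and "\<And>j. j \<in> J \<Longrightarrow> n j > 0"
    and "rep_iso K G \<rho> V (mult_sum_rep I m \<mu> Vs) (mult_sum I m Vs) \<phi>"
    and "rep_iso K G \<sigma> W (mult_sum_rep J n \<mu> Vs) (mult_sum J n Vs) \<psi>"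
  shows "linear_iso K (fun_space G V) (mult_sum I m (\<lambda>i. fun_space G (Vs i)))
           (fun_components G (copies I m) \<phi>) \<and>
         linear_iso K (fun_space G W) (mult_sum J n (\<lambda>j. fun_space G (Vs j)))
           (fun_components G (copies J n) \<psi>)"
proof -
  have Vs: "vectorspace K (Vs i)" if "i \<in> {1..r}" for i
    using \<open>full_irrep_list K G r \<mu> Vs\<close> that
    by (simp add: full_irrep_list_def irreducible_rep_def group_rep_def)
  show ?thesis
    \<comment> \<open>The inclusions of \<open>I\<close> and \<open>J\<close> in
      \<open>{1..r}\<close> make every summand a listed irreducible, hence a vector space by
      \<open>Vs\<close>.\<close>
    using assms(9,11,13,14)
    by (auto simp: rep_iso_def intro!: linear_iso_fun_components_mult_sum Vs)
qed

end
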